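(* Let $G$ be an $n$-vertex graph with VC-dimension $1$. Then $h(G)\le \max\{\frac{n}{\alpha(G)},3\}$. In particular, if $\alpha(G)=cn$ for a positive constant $c\neq \frac{2}{5}$, then $h(G)\le \lfloor \frac1c\rfloor$; and if $\alpha(G)=\frac{2n}{5}$, then $h(G)\le 3$.
   Context: For a set system $\mathcal{F}$ on ground set $X$, its VC-dimension is the largest $d$ such that some $S\subseteq X$ with $|S|=d$ satisfies: for every $B\subseteq S$ there is $A\in\mathcal{F}$ with $A\cap S=B$. The VC-dimension of a graph $G$ is that of $\{N_G(v):v\in V(G)\}$. $\alpha(G)$ is the independence number. A hitting set of $G$ is a set $T\subseteq V(G)$ meeting every maximum independent set of $G$; $h(G)$ is the minimum size of a hitting set. *)

theory Defs
  imports Complex_Main "HOL-Library.Extended_Nat"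
begin

definition simple_graph :: "'a set \<Rightarrow> 'a set set \<Rightarrow> bool" where
  "simple_graph V E \<longleftrightarrow> finite V \<and> (\<forall>e\<in>E. e \<subseteq> V \<and> card e = 2)"

definition neighborhood :: "'a set \<Rightarrow> 'a set set \<Rightarrow> 'a \<Rightarrow> 'a set" where
  "neighborhood V E v = {u \<in> V. {u, v} \<in> E}"

definition shatters :: "'a set set \<Rightarrow> 'a set \<Rightarrow> bool" where
  "shatters F S \<longleftrightarrow> (\<forall>B\<subseteq>S. \<exists>A\<in>F. A \<inter> S = B)"

(* The supremum is a maximum as soon as F is nonempty and X is finite.
   The empty set system shatters nothing and gets dimension 0. *)
definition vc_dim :: "'a set \<Rightarrow> 'a set set \<Rightarrow> enat" where
  "vc_dim X F = (SUP S\<in>{S. S \<subseteq> X \<and> finite S \<and> shatters F S}. enat (card S))"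

definition graph_vc_dim :: "'a set \<Rightarrow> 'a set set \<Rightarrow> enat" where
  "graph_vc_dim V E = vc_dim V (neighborhood V E ` V)"

definition independent_set :: "'a set \<Rightarrow> 'a set set \<Rightarrow> 'a set \<Rightarrow> bool" where
  "independent_set V E I \<longleftrightarrow> I \<subseteq> V \<and> (\<forall>u\<in>I. \<forall>v\<in>I. {u, v} \<notin> E)"

definition independence_number :: "'a set \<Rightarrow> 'a set set \<Rightarrow> nat" where
  "independence_number V E = Max (card ` {I. independent_set V E I})"

definition maximum_independent_set :: "'a set \<Rightarrow> 'a set set \<Rightarrow> 'a set \<Rightarrow> bool" where
  "maximum_independent_set V E I \<longleftrightarrow>
     independent_set V E I \<and> card I = independence_number V E"

definition hitting_set :: "'a set \<Rightarrow> 'a set set \<Rightarrow> 'a set \<Rightarrow> bool" where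
  "hitting_set V E T \<longleftrightarrow>
     T \<subseteq> V \<and> (\<forall>I. maximum_independent_set V E I \<longrightarrow> T \<inter> I \<noteq> {})"

(* Every nonempty finite graph has a hitting set, namely V. The graph without
   vertices has none (its maximum independent set is empty), so there the
   value is unspecified; such a graph has VC-dimension 0. *)
definition hitting_number :: "'a set \<Rightarrow> 'a set set \<Rightarrow> nat" where
  "hitting_number V E = Min (card ` {T. hitting_set V E T})"

end

theory Submission
  imports Defs
begin

text \<open>In VC-dimension at most 1 no pair of vertices is shattered. If the graph contains a triangle,
  this makes the non-neighbours of every vertex an independent set, so the maximum independent
  sets are pairwise disjoint, and one vertex from each of them gives at most \<open>n / \<alpha>\<close> vertices.
  If it is triangle-free, vertices with a common neighbour have nested neighborhoods, and the
  graph is bipartite, so \<open>2 \<alpha> \<ge> n\<close>. In any graph, a nonempty collection \<open>\<Lambda>\<close> of maximum independent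
  sets satisfies \<open>2 \<alpha> \<le> |\<Inter>\<Lambda>| + |\<Union>\<Lambda>|\<close>. Applied to all of them, this
  yields a common vertex if \<open>2 \<alpha> > n\<close>; if \<open>2 \<alpha> = n\<close>, applied to those avoiding a vertex \<open>v\<close>, it
  yields a \<open>w\<close> such that \<open>{v, w}\<close> is a hitting set. So \<open>h \<le> n / \<alpha>\<close> in all cases.\<close>

section \<open>Maximum independent sets\<close>

lemma finite_independent_sets:
  assumes "simple_graph V E"
  shows "finite {I. independent_set V E I}"
  by (rule finite_subset[of _ "Pow V"])
    (use assms in \<open>auto simp: simple_graph_def independent_set_def\<close>)

lemma independent_set_empty [simp]: "independent_set V E {}"
  by (simp add: independent_set_def)

lemma independent_set_finite:
  assumes "simple_graph V E" "independent_set V E I"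
  shows "finite I"
  using assms finite_subset by (auto simp: simple_graph_def independent_set_def)

lemma card_le_independence_number:
  assumes "simple_graph V E" "independent_set V E I"
  shows "card I \<le> independence_number V E"
  unfolding independence_number_def
  using assms by (intro Max_ge finite_imageI finite_independent_sets) auto

lemma maximum_independent_set_eqI:
  assumes "simple_graph V E" "maximum_independent_set V E I" "independent_set V E J" "I \<subseteq> J"
  shows "I = J"
  using assms card_le_independence_number[of V E J] independent_set_finite[of V E J]
    card_seteq[of J I] by (auto simp: maximum_independent_set_def)

lemma simple_graph_irrefl:
  assumes "simple_graph V E"
  shows "{x, x} \<notin> E"
  using assms by (force simp: simple_graph_def)

lemma independence_number_pos:
  assumes "simple_graph V E" "V \<noteq> {}"
  shows "independence_number V E > 0"
proof -
  obtain x where "x \<in> V"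
    using assms by blast
  then have "independent_set V E {x}"
    using simple_graph_irrefl[OF assms(1), of x] by (auto simp: independent_set_def)
  then show ?thesis
    using card_le_independence_number[OF assms(1), of "{x}"] by simp
qed

lemma hitting_number_le:
  assumes "simple_graph V E" "hitting_set V E T"
  shows "hitting_number V E \<le> card T"
  unfolding hitting_number_def
proof (rule Min_le)
  have "{T. hitting_set V E T} \<subseteq> Pow V"
    by (auto simp: hitting_set_def)
  then have "finite {T. hitting_set V E T}"
    by (rule finite_subset) (use assms in \<open>auto simp: simple_graph_def\<close>)
  then show "finite (card ` {T. hitting_set V E T})"
    by simp
qed (use assms in auto)

section \<open>Graphs whose independence number is at least half the order\<close>

text \<open>When \<open>S\<close> joins \<open>L\<close>, the set
  \<open>S \<inter> ?B \<union> ?A\<close> is independent: of two elements not both in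
  \<open>S\<close>, one lies in every member of \<open>L\<close> and the other in some member, so a
  single member contains both. Hence this set has at most \<open>card S\<close> elements, and
  inclusion-exclusion passes the bound on.\<close>

lemma card_Inter_Union_maximum_independent_sets:
  assumes G: "simple_graph V E"
    and "finite L" "L \<noteq> {}" "\<And>I. I \<in> L \<Longrightarrow> maximum_independent_set V E I"
  shows "2 * independence_number V E \<le> card (\<Inter>L) + card (\<Union>L)"
  using assms(2-)
proof (induction L rule: finite_ne_induct)
  case (singleton I)
  then show ?case
    by (simp add: maximum_independent_set_def)
next
  case (insert S L)
  let ?A = "\<Inter>L" and ?B = "\<Union>L"
  have ind: "independent_set V E I" if "I \<in> insert S L" for I
    using insert.prems[OF that] by (simp add: maximum_independent_set_def)
  obtain I where "I \<in> L"
    using insert.hyps by blast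
  have fin: "finite S" "finite ?A" "finite ?B"
    using ind independent_set_finite[OF G] \<open>I \<in> L\<close> insert.hyps(1)
    by (auto intro: finite_subset[of ?A I])
  have "{u, v} \<notin> E" if u: "u \<in> S \<inter> ?B \<union> ?A" and v: "v \<in> S \<inter> ?B \<union> ?A" for u v
  proof (cases "u \<in> S \<and> v \<in> S")
    case True
    then show ?thesis
      using ind[of S] by (auto simp: independent_set_def)
  next
    case False
    then obtain J where "J \<in> L" "u \<in> J" "v \<in> J"
      using u v \<open>I \<in> L\<close> by blast
    then show ?thesis
      using ind[of J] by (auto simp: independent_set_def)
  qed
  then have "independent_set V E (S \<inter> ?B \<union> ?A)"
    using ind \<open>I \<in> L\<close> unfolding independent_set_def by blast
  then have "card (S \<inter> ?B \<union> ?A) \<le> card S"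
    using card_le_independence_number[OF G] insert.prems[of S]
    by (simp add: maximum_independent_set_def)
  moreover have "S \<inter> ?B \<inter> ?A = S \<inter> ?A"
    using \<open>I \<in> L\<close> by blast
  then have "card (S \<inter> ?B) + card ?A = card (S \<inter> ?B \<union> ?A) + card (S \<inter> ?A)"
    using card_Un_Int[of "S \<inter> ?B" ?A] fin by simp
  moreover have "card S + card ?B = card (S \<union> ?B) + card (S \<inter> ?B)"
    using card_Un_Int fin by blast
  ultimately have "card ?A + card ?B \<le> card (S \<inter> ?A) + card (S \<union> ?B)"
    by linarith
  then show ?case
    using insert.IH insert.prems by simp
qed

lemma hitting_number_mult_le_if_large:
  assumes G: "simple_graph V E" and "V \<noteq> {}"
    and large: "card V \<le> 2 * independence_number V E"
  shows "hitting_number V E * independence_number V E \<le> card V"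
proof -
  let ?a = "independence_number V E"
  have fin: "finite V"
    using G by (simp add: simple_graph_def)
  \<comment> \<open>The maximum independent sets inside \<open>W\<close> have a union of fewer than
    \<open>2 * ?a\<close> elements, which forces their intersection to be nonempty. If there are
    none, any vertex serves.\<close>
  have common: "\<exists>w\<in>V. \<forall>I. maximum_independent_set V E I \<and> I \<subseteq> W \<longrightarrow> w \<in> I"
    if "W \<subseteq> V" "card W < 2 * ?a" for W
  proof (cases "{I. maximum_independent_set V E I \<and> I \<subseteq> W} = {}")
    case True
    then show ?thesis
      using \<open>V \<noteq> {}\<close> by auto
  next
    case False
    let ?L = "{I. maximum_independent_set V E I \<and> I \<subseteq> W}"
    have "finite W"
      using fin that finite_subset by blast
    then have "finite ?L"
      by (auto intro: finite_subset[of _ "Pow W"])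
    then have "2 * ?a \<le> card (\<Inter>?L) + card (\<Union>?L)"
      by (intro card_Inter_Union_maximum_independent_sets[OF G _ False]) blast+
    moreover have "card (\<Union>?L) \<le> card W"
      using \<open>finite W\<close> by (intro card_mono) auto
    ultimately have "\<Inter>?L \<noteq> {}"
      using that(2) by fastforce
    then obtain w where "w \<in> \<Inter>?L"
      by blast
    then show ?thesis
      using False that(1) by (intro bexI[of _ w]) auto
  qed
  have sub: "I \<subseteq> V" if "maximum_independent_set V E I" for I
    using that by (simp add: maximum_independent_set_def independent_set_def)
  show ?thesis
  proof (cases "card V < 2 * ?a")
    case True
    then obtain w where w: "w \<in> V" "\<And>I. maximum_independent_set V E I \<Longrightarrow> w \<in> I"
      using common[of V] sub by auto
    then have "hitting_set V E {w}"
      by (auto simp: hitting_set_def)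
    then have "hitting_number V E \<le> 1"
      using hitting_number_le[OF G] by fastforce
    moreover have "?a \<in> card ` {I. independent_set V E I}"
      unfolding independence_number_def
      by (intro Max_in finite_imageI finite_independent_sets[OF G]) (use independent_set_empty in blast)
    then have "?a \<le> card V"
      using fin by (auto simp: independent_set_def intro: card_mono)
    ultimately show ?thesis
      using mult_le_mono by fastforce
  next
    case False
    obtain v where v: "v \<in> V"
      using \<open>V \<noteq> {}\<close> by blast
    have "card (V - {v}) < 2 * ?a"
      using v fin large card_Diff1_less[of V v] by linarith
    then obtain w where w: "w \<in> V"
      "\<And>I. maximum_independent_set V E I \<Longrightarrow> I \<subseteq> V - {v} \<Longrightarrow> w \<in> I"
      using common[of "V - {v}"] by blast
    \<comment> \<open>A maximum independent set contains \<open>v\<close> or lies in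
      \<open>V - {v}\<close> and then contains \<open>w\<close>.\<close>
    have "hitting_set V E {v, w}"
      using v w sub unfolding hitting_set_def by blast
    then have "hitting_number V E \<le> 2"
      using hitting_number_le[OF G] card_insert_le_m1[of 2 "{w}" v] by fastforce
    then have "hitting_number V E * ?a \<le> 2 * ?a"
      by (rule mult_right_mono) simp
    then show ?thesis
      using False by linarith
  qed
qed

section \<open>Graphs of VC-dimension at most 1\<close>

lemma vc_dim_le_1_pair_not_shattered:
  assumes "graph_vc_dim V E \<le> 1" "u \<in> V" "v \<in> V" "u \<noteq> v"
  shows "\<not> shatters (neighborhood V E ` V) {u, v}"
proof
  assume "shatters (neighborhood V E ` V) {u, v}"
  then have "enat (card {u, v}) \<le> graph_vc_dim V E"
    unfolding graph_vc_dim_def vc_dim_def using assms by (intro SUP_upper) auto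
  then have "enat (card {u, v}) \<le> 1"
    using assms(1) by (rule order_trans)
  then show False
    using \<open>u \<noteq> v\<close> by (simp add: one_enat_def)
qed

text \<open>The neighborhoods of \<open>a\<close>, \<open>b\<close>, \<open>c\<close> trace
  \<open>{u, v}\<close>, \<open>{u}\<close>, \<open>{v}\<close> on the pair; a vertex
  \<open>d\<close> adjacent to neither would supply the empty trace and shatter it.\<close>

lemma vc_dim_le_1_patterns:
  assumes vc: "graph_vc_dim V E \<le> 1" and "u \<in> V" "v \<in> V" "u \<noteq> v"
    and "a \<in> V" "{u, a} \<in> E" "{v, a} \<in> E"
    and "b \<in> V" "{u, b} \<in> E" "{v, b} \<notin> E"
    and "c \<in> V" "{u, c} \<notin> E" "{v, c} \<in> E"
  shows "d \<in> V \<Longrightarrow> {u, d} \<in> E \<or> {v, d} \<in> E"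
proof (rule ccontr)
  assume d: "d \<in> V" "\<not> ({u, d} \<in> E \<or> {v, d} \<in> E)"
  have "shatters (neighborhood V E ` V) {u, v}"
    unfolding shatters_def
  proof (intro allI impI)
    fix B assume "B \<subseteq> {u, v}"
    then consider "B = {u, v}" | "B = {u}" | "B = {v}" | "B = {}"
      by blast
    then show "\<exists>A\<in>neighborhood V E ` V. A \<inter> {u, v} = B"
    proof cases
      case 1
      then show ?thesis
        using assms by (intro bexI[of _ "neighborhood V E a"]) (auto simp: neighborhood_def)
    next
      case 2
      then show ?thesis
        using assms by (intro bexI[of _ "neighborhood V E b"]) (auto simp: neighborhood_def)
    next
      case 3
      then show ?thesis
        using assms by (intro bexI[of _ "neighborhood V E c"]) (auto simp: neighborhood_def)
    next
      case 4
      then show ?thesis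
        using assms d by (intro bexI[of _ "neighborhood V E d"]) (auto simp: neighborhood_def)
    qed
  qed
  then show False
    using vc_dim_le_1_pair_not_shattered[OF assms(1-4)] by contradiction
qed

section \<open>Graphs containing a triangle\<close>

text \<open>The triangle itself supplies the three nonempty traces on \<open>{u, v}\<close>:
  \<open>w\<close> sees both ends, and each end sees only the other, as there are no loops.\<close>

lemma triangle_edge_dominates:
  assumes "simple_graph V E" "graph_vc_dim V E \<le> 1"
    and "{u, v} \<in> E" "{u, w} \<in> E" "{v, w} \<in> E" "x \<in> V"
  shows "{u, x} \<in> E \<or> {v, x} \<in> E"
proof -
  have V: "u \<in> V" "v \<in> V" "w \<in> V"
    using assms(1,3,4) by (auto simp: simple_graph_def)
  have "u \<noteq> v"
    using assms(3) simple_graph_irrefl[OF assms(1)] by auto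
  show ?thesis
    by (rule vc_dim_le_1_patterns[of V E u v w v u])
      (use assms V \<open>u \<noteq> v\<close> simple_graph_irrefl[OF assms(1)] in \<open>auto simp: insert_commute\<close>)
qed

lemma nonneighbors_independent_if_triangle:
  assumes G: "simple_graph V E" and vc: "graph_vc_dim V E \<le> 1"
    and tri: "{u, v} \<in> E" "{u, w} \<in> E" "{v, w} \<in> E" and x: "x \<in> V"
  shows "independent_set V E {y \<in> V. {x, y} \<notin> E}"
proof -
  note dom = triangle_edge_dominates[OF G vc]
  have comm: "{a, b} \<in> E \<longleftrightarrow> {b, a} \<in> E" for a b
    by (simp add: insert_commute)
  \<comment> \<open>Each of the three edges of the triangle dominates \<open>x\<close>, so at most
    one corner is not adjacent to \<open>x\<close>, and \<open>x\<close> lies in a triangle with the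
    other two.\<close>
  obtain p q where pq: "{p, q} \<in> E" "{x, p} \<in> E" "{x, q} \<in> E"
    using dom[of u v w x] dom[of u w v x] dom[of v w u x] tri x comm by metis
  have False if y: "y \<in> V" "{x, y} \<notin> E" and z: "z \<in> V" "{x, z} \<notin> E" and "{y, z} \<in> E" for y z
  proof -
    have "{p, y} \<in> E" "{p, z} \<in> E"
      using dom[of x p q] pq y z by blast+
    \<comment> \<open>Now \<open>y\<close>, \<open>z\<close>, \<open>p\<close> form a triangle,
      whose edge \<open>{y, z}\<close> must dominate \<open>x\<close>.\<close>
    then have "{y, x} \<in> E \<or> {z, x} \<in> E"
      using dom[of y z p x] that(5) x comm by blast
    then show False
      using y z comm by blast
  qed
  then show ?thesis
    by (auto simp: independent_set_def)
qed

text \<open>By maximality, a maximum independent set is the set of non-neighbors of each of its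
  vertices, so two that share a vertex coincide.\<close>

lemma hitting_number_mult_le_if_nonneighbors_independent:
  assumes G: "simple_graph V E" and "V \<noteq> {}"
    and ind: "\<And>x. x \<in> V \<Longrightarrow> independent_set V E {y \<in> V. {x, y} \<notin> E}"
  shows "hitting_number V E * independence_number V E \<le> card V"
proof -
  let ?M = "{I. maximum_independent_set V E I}"
  have eq: "I = {y \<in> V. {x, y} \<notin> E}" if "I \<in> ?M" "x \<in> I" for I x
    by (rule maximum_independent_set_eqI[OF G])
      (use that ind in \<open>auto simp: maximum_independent_set_def independent_set_def\<close>)
  have disj: "I \<inter> J = {}" if "I \<in> ?M" "J \<in> ?M" "I \<noteq> J" for I J
    using eq that by blast
  have ne: "I \<noteq> {}" if "I \<in> ?M" for I
    using that independence_number_pos[OF G \<open>V \<noteq> {}\<close>]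
    by (auto simp: maximum_independent_set_def)
  have finM: "finite ?M"
    by (rule finite_subset[OF _ finite_independent_sets[OF G]])
      (auto simp: maximum_independent_set_def)
  define T where "T = (\<lambda>I. SOME x. x \<in> I) ` ?M"
  have T: "(SOME x. x \<in> I) \<in> I" if "I \<in> ?M" for I
    using ne[OF that] by (simp add: some_in_eq)
  have "T \<inter> I \<noteq> {}" if "I \<in> ?M" for I
    using T[OF that] that unfolding T_def by blast
  moreover have "T \<subseteq> V"
  proof
    fix x assume "x \<in> T"
    then obtain I where "I \<in> ?M" "x = (SOME x. x \<in> I)"
      by (auto simp: T_def)
    then show "x \<in> V"
      using T[of I] by (auto simp: maximum_independent_set_def independent_set_def)
  qed
  ultimately have "hitting_set V E T"
    by (simp add: hitting_set_def)
  then have "hitting_number V E \<le> card T"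
    by (rule hitting_number_le[OF G])
  also have "card T \<le> card ?M"
    unfolding T_def using finM by (rule card_image_le)
  finally have "hitting_number V E * independence_number V E
      \<le> card ?M * independence_number V E"
    by simp
  also have "\<dots> = (\<Sum>I\<in>?M. card I)"
    by (simp add: maximum_independent_set_def)
  also have "\<dots> = card (\<Union>?M)"
    using disj independent_set_finite[OF G]
    by (intro card_Union_disjoint[symmetric])
      (auto simp: pairwise_def disjnt_def maximum_independent_set_def)
  also have "\<dots> \<le> card V"
    using G by (intro card_mono)
      (auto simp: simple_graph_def maximum_independent_set_def independent_set_def)
  finally show ?thesis .
qed

section \<open>Triangle-free graphs\<close>

text \<open>A vertex \<open>u\<close> with a largest neighborhood spans, together with its neighbors and the vertices
  at distance 2, a whole connected component: the neighborhoods of the latter are nested with,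
  hence contained in, that of \<open>u\<close>. So the component can be split off.\<close>

lemma bipartite_if_nested_neighborhoods:
  fixes R :: "'a \<Rightarrow> 'a \<Rightarrow> bool"
  assumes "finite V"
    and sym: "\<And>x y. R x y \<Longrightarrow> R y x"
    and tri: "\<And>x y z. R x y \<Longrightarrow> R y z \<Longrightarrow> \<not> R x z"
    and nest: "\<And>x y z. \<lbrakk>x \<in> V; y \<in> V; z \<in> V; R x z; R y z\<rbrakk> \<Longrightarrow>
      {w \<in> V. R x w} \<subseteq> {w \<in> V. R y w} \<or> {w \<in> V. R y w} \<subseteq> {w \<in> V. R x w}"
  shows "\<exists>A\<subseteq>V. (\<forall>x\<in>A. \<forall>y\<in>A. \<not> R x y) \<and> (\<forall>x\<in>V - A. \<forall>y\<in>V - A. \<not> R x y)"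
  using assms(1) nest
\<comment> \<open>Nestedness refers to \<open>V\<close> and must be carried through the induction;
  symmetry and triangle-freeness concern \<open>R\<close> alone and stay fixed.\<close>
proof (induction V rule: finite_psubset_induct)
  case (psubset V)
  define N where "N x = {w \<in> V. R x w}" for x
  show ?case
  proof (cases "V = {}")
    case False
    define m where "m = Max ((\<lambda>x. card (N x)) ` V)"
    have "m \<in> (\<lambda>x. card (N x)) ` V"
      unfolding m_def using psubset.hyps \<open>V \<noteq> {}\<close> by (intro Max_in) auto
    moreover have "card (N x) \<le> m" if "x \<in> V" for x
      unfolding m_def using psubset.hyps that by (intro Max_ge) auto
    ultimately obtain u where u: "u \<in> V" "\<And>x. x \<in> V \<Longrightarrow> card (N x) \<le> card (N u)"
      by blast
    define B where "B = insert u {b \<in> V. \<exists>a\<in>N u. R b a}"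
    have B: "N b \<subseteq> N u" if b: "b \<in> B" for b
    proof (cases "b = u")
      case False
      then obtain a where "b \<in> V" "a \<in> N u" "R b a"
        using b by (auto simp: B_def)
      then have "N b \<subseteq> N u \<or> N u \<subseteq> N b"
        using psubset.prems[of b u a] u(1) by (auto simp: N_def)
      \<comment> \<open>The choice of \<open>u\<close> with a largest neighborhood excludes a proper
        inclusion.\<close>
      moreover have "N b = N u" if "N u \<subseteq> N b"
        using that u(2)[OF \<open>b \<in> V\<close>] psubset.hyps by (intro card_seteq[symmetric]) (auto simp: N_def)
      ultimately show ?thesis
        by blast
    qed simp
    define W where "W = V - (N u \<union> B)"
    have "\<exists>A\<subseteq>W. (\<forall>x\<in>A. \<forall>y\<in>A. \<not> R x y) \<and> (\<forall>x\<in>W - A. \<forall>y\<in>W - A. \<not> R x y)"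
    proof (rule psubset.IH)
      show "W \<subset> V"
        using u(1) by (auto simp: W_def B_def)
    next
      fix x y z assume "x \<in> W" "y \<in> W" "z \<in> W" "R x z" "R y z"
      then show "{w \<in> W. R x w} \<subseteq> {w \<in> W. R y w} \<or> {w \<in> W. R y w} \<subseteq> {w \<in> W. R x w}"
        using psubset.prems[of x y z] by (auto simp: W_def)
    qed
    then obtain A where A: "A \<subseteq> W" "\<forall>x\<in>A. \<forall>y\<in>A. \<not> R x y" "\<forall>x\<in>W - A. \<forall>y\<in>W - A. \<not> R x y"
      by blast
    have BV: "B \<subseteq> V" and NV: "N u \<subseteq> V"
      using u(1) by (auto simp: B_def N_def)
    have disj: "N u \<inter> B = {}"
      using tri[of u u u] tri[of u _ _] unfolding B_def N_def by blast
    have indN: "\<not> R x y" if "x \<in> N u" "y \<in> N u" for x y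
      using that tri[of u x y] by (auto simp: N_def)
    \<comment> \<open>All neighbors of \<open>B\<close> within \<open>V\<close> lie in
      \<open>N u\<close>, hence neither in \<open>B\<close> nor in \<open>W\<close>.\<close>
    have indB: "\<not> R x y" if "x \<in> B" "y \<in> B" for x y
      using that B[of x] disj BV by (auto simp: N_def)
    have WB: "\<not> R x y" "\<not> R y x" if "x \<in> W" "y \<in> B" for x y
      using that B[of y] sym[of x y] by (auto simp: W_def N_def)
    have WN: "\<not> R x y" "\<not> R y x" if "x \<in> W" "y \<in> N u" for x y
      using that sym[of y x] by (auto simp: W_def B_def)
    \<comment> \<open>The new color classes are \<open>A \<union> B\<close> and
      \<open>(W - A) \<union> N u\<close>; no edge joins \<open>W\<close> to the removed
      part.\<close>
    have VA: "V - (A \<union> B) = (W - A) \<union> N u"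
      using A(1) disj BV NV by (auto simp: W_def)
    have "\<forall>x\<in>A \<union> B. \<forall>y\<in>A \<union> B. \<not> R x y"
      using A(1,2) indB WB by blast
    moreover have "\<forall>x\<in>V - (A \<union> B). \<forall>y\<in>V - (A \<union> B). \<not> R x y"
      unfolding VA using A(3) indN WN by blast
    ultimately show ?thesis
      using A(1) BV by (intro exI[of _ "A \<union> B"]) (auto simp: W_def)
  qed auto
qed

text \<open>If \<open>x\<close> and \<open>y\<close> have a common neighbor but incomparable
  neighborhoods, three traces on \<open>{x, y}\<close> are realized. The fourth must be missing, yet
  \<open>x\<close> itself realizes it unless \<open>x\<close> and \<open>y\<close> are adjacent,
  which would create a triangle. So neighborhoods are nested, and both color classes of the
  resulting bipartition are independent.\<close>

lemma independence_number_ge_half_if_triangle_free: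
  assumes G: "simple_graph V E" and vc: "graph_vc_dim V E \<le> 1"
    and tri: "\<And>x y z. {x, y} \<in> E \<Longrightarrow> {y, z} \<in> E \<Longrightarrow> {x, z} \<notin> E"
  shows "card V \<le> 2 * independence_number V E"
proof -
  have fin: "finite V"
    using G by (simp add: simple_graph_def)
  have "\<exists>A\<subseteq>V. (\<forall>x\<in>A. \<forall>y\<in>A. {x, y} \<notin> E) \<and> (\<forall>x\<in>V - A. \<forall>y\<in>V - A. {x, y} \<notin> E)"
  proof (rule bipartite_if_nested_neighborhoods[OF fin, where R = "\<lambda>x y. {x, y} \<in> E"])
    fix x y z assume xyz: "x \<in> V" "y \<in> V" "z \<in> V" "{x, z} \<in> E" "{y, z} \<in> E"
    show "{w \<in> V. {x, w} \<in> E} \<subseteq> {w \<in> V. {y, w} \<in> E} \<or>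
          {w \<in> V. {y, w} \<in> E} \<subseteq> {w \<in> V. {x, w} \<in> E}"
    proof (rule ccontr)
      assume "\<not> ?thesis"
      then obtain b c where bc: "b \<in> V" "{x, b} \<in> E" "{y, b} \<notin> E"
        "c \<in> V" "{x, c} \<notin> E" "{y, c} \<in> E"
        by blast
      then have "{x, x} \<in> E \<or> {y, x} \<in> E"
        using vc_dim_le_1_patterns[OF vc, of x y z b c x] xyz by blast
      then have "{y, x} \<in> E"
        using simple_graph_irrefl[OF G] by blast
      then show False
        using tri[of y x z] xyz by blast
    qed
  qed (use tri in \<open>auto simp: insert_commute\<close>)
  then obtain A where A: "A \<subseteq> V" "independent_set V E A" "independent_set V E (V - A)"
    by (auto simp: independent_set_def)
  have "card V = card A + card (V - A)"
    using A(1) fin by (simp add: card_Diff_subset card_mono finite_subset)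
  then show ?thesis
    using card_le_independence_number[OF G A(2)] card_le_independence_number[OF G A(3)] by linarith
qed

section \<open>Combining the two cases\<close>

lemma hitting_number_mult_le:
  assumes G: "simple_graph V E" and "V \<noteq> {}" and vc: "graph_vc_dim V E \<le> 1"
  shows "hitting_number V E * independence_number V E \<le> card V"
proof (cases "\<exists>u v w. {u, v} \<in> E \<and> {u, w} \<in> E \<and> {v, w} \<in> E")
  case True
  then show ?thesis
    using nonneighbors_independent_if_triangle[OF G vc]
      hitting_number_mult_le_if_nonneighbors_independent[OF G \<open>V \<noteq> {}\<close>] by blast
next
  case False
  then show ?thesis
    using independence_number_ge_half_if_triangle_free[OF G vc]
      hitting_number_mult_le_if_large[OF G \<open>V \<noteq> {}\<close>] by blast
qed

theorem theorem1p7: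
  fixes V :: "'a set" and E :: "'a set set" and n :: nat
  assumes "simple_graph V E"
    and "card V = n"
    and "graph_vc_dim V E = 1"
  shows "real (hitting_number V E) \<le> max (real n / real (independence_number V E)) 3
    \<and> (\<forall>c::real. c > 0 \<and> c \<noteq> 2 / 5 \<and> real (independence_number V E) = c * real n
          \<longrightarrow> int (hitting_number V E) \<le> \<lfloor>1 / c\<rfloor>)
    \<and> (real (independence_number V E) = 2 * real n / 5 \<longrightarrow> hitting_number V E \<le> 3)"
proof -
  let ?h = "real (hitting_number V E)" and ?a = "real (independence_number V E)"
  have "V \<noteq> {}"
  proof
    assume "V = {}"
    \<comment> \<open>Without vertices there are no neighborhoods, so not even the empty set is
      shattered, and the supremum over the empty family is 0.\<close>
    then have none: "{S. S \<subseteq> V \<and> finite S \<and> shatters (neighborhood V E ` V) S} = {}"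
      unfolding shatters_def by blast
    have "graph_vc_dim V E = 0"
      unfolding graph_vc_dim_def vc_dim_def none by (simp add: bot_enat_def)
    then show False
      using assms(3) by simp
  qed
  then have "n > 0" and a: "?a > 0"
    using assms(1,2) independence_number_pos[OF assms(1)]
    by (auto simp: simple_graph_def card_gt_0_iff)
  have "?h * ?a \<le> real n"
    using hitting_number_mult_le[OF assms(1) \<open>V \<noteq> {}\<close>] assms(2,3)
    by (metis of_nat_le_iff of_nat_mult order_refl)
  then have h: "?h \<le> real n / ?a"
    using a by (simp add: pos_le_divide_eq)
  \<comment> \<open>Here \<open>real n / ?a\<close> equals \<open>1 / c\<close>, and the integrality
    of the hitting number allows the floor.\<close>
  moreover have "int (hitting_number V E) \<le> \<lfloor>1 / c\<rfloor>" if "c > 0" "?a = c * real n" for c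
    using h that \<open>n > 0\<close> by (simp add: le_floor_iff)
  moreover have "hitting_number V E \<le> 3" if "?a = 2 * real n / 5"
  proof -
    have "?h \<le> 5 / 2"
      using h that \<open>n > 0\<close> by simp
    then show ?thesis
      by linarith
  qed
  ultimately show ?thesis
    by auto
qed

end
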